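(* Let $d\ge1$ and $h>0$. Let $u\in L^\infty_{loc}([0,\infty)^d)$ be Pareto-monotone with $u=0$ on $\Gamma_h$. Then for any $R>0$ we have $$|u(x)-u(y)|\le 2d^2R^{\frac{d-1}{d}}\,\|S(h,\cdot,u)\|_{L^\infty((h,R]^d)}^{\frac1d}\left(|x-y|^{\frac1d}+h^{\frac1d}\right)$$ for all $x,y\in(h,R]^d$, where $\|S(h,\cdot,u)\|_{L^\infty((h,R]^d)}=\sup_{x\in(h,R]^d}|S(h,x,u)|$.
   Context: $e_1,\dots,e_d$ are the standard basis vectors of $\mathbb{R}^d$ and $|\cdot|$ is the Euclidean norm. Write $x\leqq y$ if $x_i\le y_i$ for all $i$. A function $u:[0,\infty)^d\to\mathbb{R}$ is Pareto-monotone if $x\leqq y$ implies $u(x)\le u(y)$. Functions are defined pointwise (not up to null sets). For $h>0$, $\Gamma_h=[0,\infty)^d\setminus(h,\infty)^d$, i.e. the set of $x\in[0,\infty)^d$ with $x_i\le h$ for some $i$. For $u:[0,\infty)^d\to\mathbb{R}$ and $x\in(h,\infty)^d$, $$S(h,x,u)=\prod_{i=1}^d\frac{u(x)-u(x-he_i)}{h}.$$ *)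

theory Defs
  imports "HOL-Analysis.Analysis"
begin

text \<open>
  The space \<open>\<real>\<^sup>d\<close> is \<open>real ^ 'n\<close> with \<open>d = CARD('n)\<close>. Functions on the orthant are total functions
  whose values outside it are irrelevant. The library order on \<open>real ^ 'n\<close> is componentwise.
\<close>

definition orthant :: "(real ^ 'n) set" where
  "orthant = {x. \<forall>i. 0 \<le> x $ i}"

definition open_orthant_above :: "real \<Rightarrow> (real ^ 'n) set" where
  "open_orthant_above h = {x. \<forall>i. h < x $ i}"

definition half_open_cube :: "real \<Rightarrow> real \<Rightarrow> (real ^ 'n) set" where
  "half_open_cube h R = {x. \<forall>i. h < x $ i \<and> x $ i \<le> R}"

definition Gamma_h :: "real \<Rightarrow> (real ^ 'n) set" where
  "Gamma_h h = orthant - open_orthant_above h"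

definition pareto_monotone :: "(real ^ 'n \<Rightarrow> real) \<Rightarrow> bool" where
  "pareto_monotone u \<longleftrightarrow> mono_on orthant u"

definition Linf_loc :: "(real ^ 'n) set \<Rightarrow> (real ^ 'n \<Rightarrow> real) \<Rightarrow> bool" where
  "Linf_loc A u \<longleftrightarrow> u \<in> borel_measurable (lebesgue_on A) \<and>
     (\<forall>K. compact K \<and> K \<subseteq> A \<longrightarrow> (\<exists>C. AE x in lebesgue_on K. \<bar>u x\<bar> \<le> C))"

definition S :: "real \<Rightarrow> real ^ 'n \<Rightarrow> (real ^ 'n \<Rightarrow> real) \<Rightarrow> real" where
  "S h x u = (\<Prod>i\<in>UNIV. (u x - u (x - h *\<^sub>R axis i 1)) / h)"

text \<open>
  The norm is the pointwise supremum, not an essential one. The real-valued \<open>Sup\<close> is only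
  meaningful on nonempty sets that are bounded above; the lemma below establishes boundedness for the
  functions \<open>S h \<cdot> u\<close>.
\<close>

definition sup_norm_on :: "'a set \<Rightarrow> ('a \<Rightarrow> real) \<Rightarrow> real" where
  "sup_norm_on A f = (SUP x\<in>A. \<bar>f x\<bar>)"

lemma bdd_above_S:
  fixes u :: "real ^ 'n \<Rightarrow> real"
  assumes h: "0 < h" and u: "pareto_monotone u"
  shows "bdd_above ((\<lambda>x. \<bar>S h x u\<bar>) ` half_open_cube h R)"
proof (rule bdd_aboveI2)
  fix x :: "real ^ 'n"
  assume x: "x \<in> half_open_cube h R"
  define c :: "real ^ 'n" where "c = (\<chi> i. R)"
  have hR: "h < x $ i" "x $ i \<le> R" for i
    using x by (auto simp: half_open_cube_def)
  have R: "0 \<le> R"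
    using hR[of undefined] h by linarith
  have bounds: "u 0 \<le> u y \<and> u y \<le> u c" if "\<And>i. 0 \<le> y $ i \<and> y $ i \<le> R" for y
    using u that R unfolding pareto_monotone_def
    by (auto intro!: mono_onD[of orthant u] simp: orthant_def less_eq_vec_def c_def)
  have "\<bar>(u x - u (x - h *\<^sub>R axis i 1)) / h\<bar> \<le> (u c - u 0) / h" for i
  proof -
    have "u 0 \<le> u x \<and> u x \<le> u c"
      using hR h by (intro bounds) (meson less_imp_le less_trans)
    moreover have "u 0 \<le> u (x - h *\<^sub>R axis i 1) \<and> u (x - h *\<^sub>R axis i 1) \<le> u c"
    proof (rule bounds)
      fix j
      show "0 \<le> (x - h *\<^sub>R axis i 1) $ j \<and> (x - h *\<^sub>R axis i 1) $ j \<le> R"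
        using hR[of j] h by (auto simp: axis_def)
    qed
    ultimately have "\<bar>u x - u (x - h *\<^sub>R axis i 1)\<bar> \<le> u c - u 0"
      by linarith
    then show ?thesis
      using h by (simp add: abs_divide divide_right_mono)
  qed
  then show "\<bar>S h x u\<bar> \<le> (\<Prod>i\<in>(UNIV :: 'n set). (u (\<chi> i. R) - u 0) / h)"
    unfolding S_def abs_prod c_def by (intro prod_mono) auto
qed

end

theory Submission
  imports Defs
begin

text \<open>
  A monotone \<open>u\<close> is a subsolution of the scheme \<open>S = M\<close>, where \<open>M\<close> is the supremum of \<open>S\<close>. Fix a
  coordinate \<open>i\<close> and a level \<open>c\<close>. With \<open>q = z - (c - h) e\<^sub>i\<close>, the function
  \<open>v z = d (M q\<^sub>1 \<cdots> q\<^sub>d)\<^bsup>1/d\<^esup>\<close> is a supersolution, by concavity in each variable, and it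
  remains one after adding the monotone function \<open>z \<mapsto> u (z with z\<^sub>i replaced by c)\<close>. The sum
  dominates \<open>u\<close> for \<open>z\<^sub>i \<le> c\<close> and on \<open>\<Gamma>\<^sub>h\<close>, hence everywhere by discrete comparison. This
  is the Hoelder bound in direction \<open>i\<close>; moving from \<open>y\<close> to \<open>max x y\<close> one coordinate at a
  time gives the theorem.
\<close>

definition upd :: "real ^ 'n \<Rightarrow> 'n \<Rightarrow> real \<Rightarrow> real ^ 'n" where
  "upd z i c = (\<chi> j. if j = i then c else z $ j)"

lemma upd_nth [simp]: "upd z i c $ j = (if j = i then c else z $ j)"
  by (simp add: upd_def)

section \<open>Elementary inequalities for the \<open>d\<close>-th root\<close>

lemma root_le_tangent_at_1:
  assumes "0 < d" "0 \<le> r"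
  shows "root d r \<le> 1 + (r - 1) / real d"
proof -
  have ge: "-1 \<le> (r - 1) / real d"
    using assms by (simp add: field_simps)
  have "r \<le> (1 + (r - 1) / real d) ^ d"
    using Bernoulli_inequality[OF ge, of d] assms by simp
  then have "root d r \<le> root d ((1 + (r - 1) / real d) ^ d)"
    using assms by simp
  also have "\<dots> = 1 + (r - 1) / real d"
    using assms ge by (intro real_root_power_cancel) auto
  finally show ?thesis .
qed

lemma power_add_power_le:
  fixes a b :: real
  assumes "0 < d" "0 \<le> a" "0 \<le> b"
  shows "a ^ d + b ^ d \<le> (a + b) ^ d"
  using assms(1)
proof (induction d rule: nat_induct_non_zero)
  case (Suc d)
  have "a ^ Suc d + b ^ Suc d \<le> (a + b) * (a ^ d + b ^ d)"
    using assms by (simp add: algebra_simps)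
  also have "\<dots> \<le> (a + b) * (a + b) ^ d"
    using Suc assms by (intro mult_left_mono) auto
  finally show ?case
    by simp
qed simp

text \<open>Superadditivity of the \<open>d\<close>-th power, applied to the roots of
  \<open>a\<close> and \<open>b\<close>. It separates \<open>norm (x - y)\<close> from
  \<open>h\<close> in the final bound.\<close>

lemma root_add_le:
  assumes "0 < d" "0 \<le> a" "0 \<le> b"
  shows "root d (a + b) \<le> root d a + root d b"
proof -
  have "a + b = root d a ^ d + root d b ^ d"
    using assms by simp
  also have "\<dots> \<le> (root d a + root d b) ^ d"
    using assms by (intro power_add_power_le) auto
  finally have "root d (a + b) \<le> root d ((root d a + root d b) ^ d)"
    using assms by simp
  then show ?thesis
    using assms by (simp add: real_root_power_cancel)
qed

text \<open>At \<open>a = 0\<close> both sides vanish, which covers \<open>x = y\<close> and a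
  vanishing supremum of \<open>S\<close>.\<close>

lemma powr_inverse_eq_root:
  assumes "0 < d" "0 \<le> a"
  shows "a powr (1 / real d) = root d a"
  using assms by (cases "a = 0") (auto simp: root_powr_inverse)

section \<open>The supersolution built from the root of a product\<close>

lemma prod_nth_minus_axis:
  fixes q :: "real ^ 'n"
  assumes "q $ j \<noteq> 0"
  shows "(\<Prod>k\<in>UNIV. (q - h *\<^sub>R axis j 1) $ k) = (\<Prod>k\<in>UNIV. q $ k) * (1 - h / q $ j)"
proof -
  have "(\<Prod>k\<in>UNIV. (q - h *\<^sub>R axis j 1) $ k) = (q $ j - h) * (\<Prod>k\<in>UNIV - {j}. q $ k)"
    by (subst prod.remove[of _ j]) (auto simp: axis_def intro!: prod.cong)
  moreover have "(\<Prod>k\<in>UNIV. q $ k) = q $ j * (\<Prod>k\<in>UNIV - {j}. q $ k)"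
    by (subst prod.remove[of _ j]) auto
  moreover have "q $ j - h = q $ j * (1 - h / q $ j)"
    using assms by (simp add: field_simps)
  ultimately show ?thesis
    by simp
qed

text \<open>Stepping back by \<open>h\<close> in direction \<open>j\<close> multiplies the product
  by \<open>1 - h / q $ j\<close>, which is nonnegative since \<open>h \<le> q $ j\<close>; the
  tangent bound for the root then applies. After division by \<open>h\<close>, the lower bounds for
  all \<open>j\<close> multiply to 1, so \<open>d\<close> times the root of the product is a
  supersolution for the right-hand side 1.\<close>

lemma root_prod_diff_ge:
  fixes q :: "real ^ 'n"
  assumes pos: "\<And>k. 0 < q $ k" and le: "h \<le> q $ j"
  defines "d \<equiv> CARD('n)"
  shows "root d (\<Prod>k\<in>UNIV. q $ k) * (h / q $ j)
    \<le> real d * (root d (\<Prod>k\<in>UNIV. q $ k) - root d (\<Prod>k\<in>UNIV. (q - h *\<^sub>R axis j 1) $ k))"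
proof -
  have d: "0 < d"
    by (simp add: d_def)
  let ?p = "root d (\<Prod>k\<in>UNIV. q $ k)"
  have p: "0 \<le> ?p"
    by (intro real_root_ge_zero prod_nonneg ballI less_imp_le pos)
  have "root d (1 - h / q $ j) \<le> 1 - h / q $ j / real d"
    using root_le_tangent_at_1[OF d, of "1 - h / q $ j"] le pos[of j] by simp
  then have "real d * root d (1 - h / q $ j) \<le> real d * (1 - h / q $ j / real d)"
    by (intro mult_left_mono) auto
  also have "\<dots> = real d - h / q $ j"
    using d by (simp add: right_diff_distrib)
  finally have "real d * root d (1 - h / q $ j) \<le> real d - h / q $ j" .
  then have "?p * (h / q $ j) \<le> ?p * (real d * (1 - root d (1 - h / q $ j)))"
    using p by (intro mult_left_mono) (simp_all add: algebra_simps)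
  also have "\<dots> = real d * (?p - ?p * root d (1 - h / q $ j))"
    by (simp add: algebra_simps)
  also have "\<dots> = real d * (?p - root d (\<Prod>k\<in>UNIV. (q - h *\<^sub>R axis j 1) $ k))"
    using pos[of j] by (subst prod_nth_minus_axis) (auto simp: real_root_mult)
  finally show ?thesis .
qed

text \<open>If the bound holds at every \<open>z - h *\<^sub>R axis j 1\<close> but fails at
  \<open>z\<close>, then each backward difference of \<open>u\<close> is so large that
  \<open>S h z u > M\<close>. The domain reaches down to \<open>c - h\<close> because a step back
  from \<open>z $ i > c\<close> may land below \<open>c\<close>.\<close>

lemma discrete_comparison:
  fixes u :: "real ^ 'n \<Rightarrow> real"
  assumes h: "0 < h" and mono: "mono_on orthant u" and zero: "\<And>x. x \<in> Gamma_h h \<Longrightarrow> u x = 0"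
    and M: "\<And>z. z \<in> half_open_cube h R \<Longrightarrow> S h z u \<le> M" and "0 \<le> M" and c: "0 \<le> c"
    and z: "\<And>k. 0 \<le> z $ k" "\<And>k. z $ k \<le> R" "c - h \<le> z $ i"
  shows "u z \<le> u (upd z i c)
    + real CARD('n) * root CARD('n) M
      * root CARD('n) (\<Prod>k\<in>UNIV. (z - (c - h) *\<^sub>R axis i 1) $ k)"
proof -
  let ?d = "CARD('n)"
  \<comment> \<open>The shift is \<open>c - h\<close> rather than \<open>c\<close>, so that
    \<open>z $ i > c\<close> gives \<open>q z $ i > h\<close> and a step back keeps the coordinates
    of \<open>q\<close> positive.\<close>
  define q where "q z = z - (c - h) *\<^sub>R axis i 1" for z :: "real ^ 'n"
  define P where "P z = root ?d (\<Prod>k\<in>UNIV. q z $ k)" for z :: "real ^ 'n"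
  define v where "v z = real ?d * root ?d M * P z" for z :: "real ^ 'n"
  have q_nth: "q z $ k = (if k = i then z $ i - (c - h) else z $ k)" for z k
    by (simp add: q_def axis_def)
  have rM: "0 \<le> root ?d M"
    using \<open>0 \<le> M\<close> by simp
  have P_nonneg: "0 \<le> P z" if "\<And>k. 0 \<le> z $ k" "c - h \<le> z $ i" for z
    unfolding P_def using that by (auto simp: q_nth intro!: prod_nonneg)
  have v_nonneg: "0 \<le> v z" if "\<And>k. 0 \<le> z $ k" "c - h \<le> z $ i" for z
    unfolding v_def using P_nonneg[OF that] rM by simp
  have u_mono: "u a \<le> u b" if "\<And>k. 0 \<le> a $ k" "\<And>k. a $ k \<le> b $ k" for a b
    using that order_trans[OF that]
    by (intro mono_onD[OF mono]) (auto simp: orthant_def less_eq_vec_def)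
  have u_nonneg: "0 \<le> u a" if a: "\<And>k. 0 \<le> a $ k" for a
  proof -
    have "u 0 = 0"
      using h by (intro zero) (auto simp: Gamma_h_def orthant_def open_orthant_above_def not_less)
    with u_mono[of 0 a] a show ?thesis
      by simp
  qed
  \<comment> \<open>Each backward step lowers the coordinate sum by \<open>h\<close>, so induction
    on \<open>n\<close> reaches all predecessors of \<open>z\<close> at once.\<close>
  have "u z \<le> u (upd z i c) + v z"
    if "(\<Sum>k\<in>UNIV. z $ k) \<le> real n * h" "\<And>k. 0 \<le> z $ k" "\<And>k. z $ k \<le> R" "c - h \<le> z $ i"
    for n z
    using that
  proof (induction n arbitrary: z)
    case 0
    then have "z $ k \<le> 0" for k
      using member_le_sum[of k UNIV "\<lambda>k. z $ k"] by simp
    then have "z $ k \<le> h" for k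
      using h order_trans less_imp_le by metis
    then have "z \<in> Gamma_h h"
      using 0 by (auto simp: Gamma_h_def orthant_def open_orthant_above_def not_less)
    then have "u z = 0"
      by (rule zero)
    moreover have "0 \<le> u (upd z i c)"
      using 0 c by (intro u_nonneg) auto
    ultimately show ?case
      using v_nonneg[of z] 0 by simp
  next
    case (Suc n)
    have upd0: "0 \<le> u (upd z i c)"
      using Suc.prems c by (intro u_nonneg) auto
    have v0: "0 \<le> v z"
      using v_nonneg[of z] Suc.prems by simp
    \<comment> \<open>The first two cases play the part of boundary values; the scheme is used only
      in the third.\<close>
    consider "\<exists>k. z $ k \<le> h" | "z $ i \<le> c" | "\<And>k. h < z $ k" "c < z $ i"
      by (meson not_le)
    then show ?case
    proof cases
      case 1
      then have "z \<in> Gamma_h h"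
        using Suc.prems by (auto simp: Gamma_h_def orthant_def open_orthant_above_def not_less)
      then show ?thesis
        using zero upd0 v0 by simp
    next
      case 2
      have "u z \<le> u (upd z i c)"
        using 2 Suc.prems by (intro u_mono) auto
      then show ?thesis
        using v0 by simp
    next
      case 3
      have zc: "z \<in> half_open_cube h R"
        using 3 Suc.prems by (auto simp: half_open_cube_def)
      have q_gt: "h < q z $ k" for k
        using 3 by (auto simp: q_nth)
      have q_pos: "0 < q z $ k" for k
        using q_gt[of k] h by linarith
      \<comment> \<open>Failure at \<open>z\<close> and the induction hypothesis at the predecessor
        make the difference of \<open>u\<close> exceed that of \<open>v\<close>; the term
        \<open>u (upd z i c)\<close> only helps, since it does not increase under a step
        back.\<close>
      have step: "root ?d M * P z / q z $ j < (u z - u (z - h *\<^sub>R axis j 1)) / h"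
        if less: "u (upd z i c) + v z < u z" for j
      proof -
        let ?z = "z - h *\<^sub>R axis j 1"
        have nth: "?z $ k = (if k = j then z $ k - h else z $ k)" for k
          by (simp add: axis_def)
        have "(\<Sum>k\<in>UNIV. ?z $ k) = (\<Sum>k\<in>UNIV. z $ k) - h"
          by (simp add: sum_subtractf axis_def if_distrib[of "\<lambda>x. _ * x"] cong: if_cong)
        then have "u ?z \<le> u (upd ?z i c) + v ?z"
        proof (intro Suc.IH)
          show "0 \<le> ?z $ k" for k
            using 3(1)[of k] Suc.prems(2)[of k] by (auto simp only: nth split: if_splits)
          show "?z $ k \<le> R" for k
            using h Suc.prems(3)[of k] by (auto simp only: nth split: if_splits)
          show "c - h \<le> ?z $ i"
            using h 3(2) by (auto simp only: nth split: if_splits)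
        qed (use Suc.prems(1) in \<open>simp add: algebra_simps\<close>)
        also have "u (upd ?z i c) \<le> u (upd z i c)"
        proof (rule u_mono)
          show "0 \<le> upd ?z i c $ k" for k
            using 3(1)[of k] Suc.prems(2)[of k] c by (auto simp: axis_def)
          show "upd ?z i c $ k \<le> upd z i c $ k" for k
            using h by (auto simp: axis_def)
        qed
        finally have "v z - v ?z < u z - u ?z"
          using less by simp
        moreover have "q z - h *\<^sub>R axis j 1 = q ?z"
          by (simp add: q_def)
        then have "P z * (h / q z $ j) \<le> real ?d * (P z - P ?z)"
          using root_prod_diff_ge[OF q_pos less_imp_le[OF q_gt], of j] unfolding P_def by metis
        then have "root ?d M * (P z * (h / q z $ j)) \<le> root ?d M * (real ?d * (P z - P ?z))"
          using rM by (rule mult_left_mono)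
        then have "root ?d M * (P z * (h / q z $ j)) \<le> v z - v ?z"
          by (simp add: v_def algebra_simps)
        ultimately have "root ?d M * (P z * (h / q z $ j)) < u z - u ?z"
          by linarith
        then show ?thesis
          using h by (simp add: pos_less_divide_eq mult_ac)
      qed
      show ?thesis
      proof (rule ccontr)
        assume "\<not> ?thesis"
        then have less: "u (upd z i c) + v z < u z"
          by simp
        have "(\<Prod>j\<in>(UNIV::'n set). root ?d M * P z / q z $ j)
            < (\<Prod>j\<in>UNIV. (u z - u (z - h *\<^sub>R axis j 1)) / h)"
        proof (rule prod_mono_strict)
          show "0 \<le> root ?d M * P z / q z $ j \<and>
              root ?d M * P z / q z $ j \<le> (u z - u (z - h *\<^sub>R axis j 1)) / h" for j
            using step[OF less, of j] rM P_nonneg[of z] q_pos[of j] Suc.prems by simp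
          then show "0 < (u z - u (z - h *\<^sub>R axis j 1)) / h" for j
            using step[OF less, of j] by (meson le_less_trans)
        qed (use step[OF less] in auto)
        also have "\<dots> \<le> M"
          using M[OF zc] by (simp add: S_def)
        \<comment> \<open>The \<open>d\<close>-th power of \<open>P z\<close> cancels the product of
          the \<open>q z $ j\<close>. This is what fixes the normalisation of
          \<open>v\<close>.\<close>
        also have "M = (\<Prod>j\<in>(UNIV::'n set). root ?d M * P z / q z $ j)"
        proof -
          have pp: "0 < (\<Prod>k\<in>UNIV. q z $ k)"
            using q_pos by (simp add: prod_pos)
          have "P z ^ ?d = (\<Prod>k\<in>UNIV. q z $ k)"
            unfolding P_def using pp by simp
          then show ?thesis
            using \<open>0 \<le> M\<close> less_imp_neq[OF q_pos, symmetric] by (simp add: prod_dividef prod.distrib power_mult_distrib)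
        qed
        finally show False
          by simp
      qed
    qed
  qed
  moreover obtain n :: nat where "(\<Sum>k\<in>UNIV. z $ k) \<le> real n * h"
    using reals_Archimedean3[OF h] less_imp_le by metis
  ultimately show ?thesis
    using z unfolding v_def P_def q_def by metis
qed

section \<open>From one coordinate direction to the Hoelder bound\<close>

text \<open>Comparison at level \<open>c = z $ i\<close>, evaluated after raising that coordinate to
  \<open>t\<close>. The shifted coordinate is then \<open>t - z $ i + h\<close>, and the other
  \<open>d - 1\<close> factors are at most \<open>R\<close>.\<close>

lemma coordinate_increment_le:
  fixes u :: "real ^ 'n \<Rightarrow> real"
  assumes h: "0 < h" and mono: "mono_on orthant u" and zero: "\<And>x. x \<in> Gamma_h h \<Longrightarrow> u x = 0"
    and M: "\<And>z. z \<in> half_open_cube h R \<Longrightarrow> S h z u \<le> M" and "0 \<le> M"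
    and z: "z \<in> half_open_cube h R" and t: "z $ i \<le> t" "t \<le> R"
  shows "u (upd z i t) \<le> u z + real CARD('n) * root CARD('n) M
    * (root CARD('n) (R ^ (CARD('n) - 1)) * root CARD('n) (t - z $ i + h))"
proof -
  let ?d = "CARD('n)"
  let ?w = "upd z i t"
  have zk: "h < z $ k" "z $ k \<le> R" for k
    using z by (auto simp: half_open_cube_def)
  have z0: "0 \<le> z $ k" for k
    using zk(1)[of k] h by linarith
  have "u ?w \<le> u (upd ?w i (z $ i)) + real ?d * root ?d M
      * root ?d (\<Prod>k\<in>UNIV. (?w - (z $ i - h) *\<^sub>R axis i 1) $ k)"
    using z0 zk t h order_trans[OF z0 t(1)]
    by (intro discrete_comparison[OF h mono zero M \<open>0 \<le> M\<close>]) auto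
  also have "upd ?w i (z $ i) = z"
    by (simp add: vec_eq_iff)
  also have "(\<Prod>k\<in>UNIV. (?w - (z $ i - h) *\<^sub>R axis i 1) $ k)
      = (t - z $ i + h) * (\<Prod>k\<in>UNIV - {i}. z $ k)"
    by (subst prod.remove[of _ i]) (auto simp: axis_def intro!: prod.cong)
  also have "\<dots> \<le> (t - z $ i + h) * (\<Prod>k\<in>UNIV - {i}. R)"
    using zk z0 t h by (intro mult_left_mono prod_mono) auto
  also have "\<dots> = R ^ (?d - 1) * (t - z $ i + h)"
    by (simp add: card_Diff_singleton)
  finally show ?thesis
    using \<open>0 \<le> M\<close> by (simp add: real_root_mult mult_left_mono)
qed

text \<open>The route from \<open>y\<close> to the componentwise maximum of \<open>x\<close> and
  \<open>y\<close> only moves upward, as the one-coordinate bound requires, and takes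
  \<open>d\<close> moves, whence the outer factor. Monotonicity then bounds \<open>u x\<close> by
  the value at the maximum.\<close>

lemma increment_le:
  fixes u :: "real ^ 'n \<Rightarrow> real"
  assumes h: "0 < h" and mono: "mono_on orthant u" and zero: "\<And>x. x \<in> Gamma_h h \<Longrightarrow> u x = 0"
    and M: "\<And>z. z \<in> half_open_cube h R \<Longrightarrow> S h z u \<le> M" and "0 \<le> M"
    and x: "x \<in> half_open_cube h R" and y: "y \<in> half_open_cube h R"
  shows "u x \<le> u y + real CARD('n) * (real CARD('n) * root CARD('n) M
    * (root CARD('n) (R ^ (CARD('n) - 1)) * root CARD('n) (norm (x - y) + h)))"
proof -
  let ?d = "CARD('n)"
  define B where "B = real ?d * root ?d M
    * (root ?d (R ^ (?d - 1)) * root ?d (norm (x - y) + h))"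
  \<comment> \<open>\<open>A\<close> collects the coordinates already raised; every
    \<open>m A\<close> stays in the cube.\<close>
  define m where "m A = (\<chi> k. if k \<in> A then max (x $ k) (y $ k) else y $ k)" for A
  have xk: "h < x $ k" "x $ k \<le> R" and yk: "h < y $ k" "y $ k \<le> R" for k
    using x y by (auto simp: half_open_cube_def)
  have R: "0 \<le> R"
    using xk[of undefined] h by linarith
  have "u (m A) \<le> u y + real (card A) * B" for A
  proof (induction A rule: finite_induct[OF finite])
    case 1
    then show ?case
      by (simp add: m_def)
  next
    case (2 i A)
    let ?t = "max (x $ i) (y $ i)"
    have mi: "m A $ i = y $ i"
      using 2 by (simp add: m_def)
    have "m (insert i A) = upd (m A) i ?t"
      by (auto simp: m_def vec_eq_iff)
    also have "u \<dots> \<le> u (m A) + real ?d * root ?d M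
        * (root ?d (R ^ (?d - 1)) * root ?d (?t - m A $ i + h))"
      using xk yk mi
      by (intro coordinate_increment_le[OF h mono zero M \<open>0 \<le> M\<close>])
        (auto simp: half_open_cube_def m_def less_max_iff_disj)
    also have "\<dots> \<le> u (m A) + B"
    proof -
      have "?t - m A $ i \<le> norm (x - y)"
        using component_le_norm_cart[of "x - y" i] mi by auto
      then show ?thesis
        unfolding B_def using R \<open>0 \<le> M\<close> by (auto intro!: mult_left_mono)
    qed
    also have "\<dots> \<le> u y + real (card (insert i A)) * B"
      using 2 by (simp add: algebra_simps)
    finally show ?case .
  qed
  from this[of UNIV] have "u (m UNIV) \<le> u y + real ?d * B" .
  moreover have "u x \<le> u (m UNIV)"
  proof (rule mono_onD[OF mono])
    show "x \<in> orthant" "m UNIV \<in> orthant"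
      using less_trans[OF h xk(1)] by (auto simp: orthant_def m_def le_max_iff_disj less_imp_le)
    show "x \<le> m UNIV"
      by (simp add: less_eq_vec_def m_def)
  qed
  ultimately show ?thesis
    by (simp add: B_def)
qed

theorem lemma2:
  fixes u :: "real ^ 'n \<Rightarrow> real" and h R :: real
  assumes "h > 0"
    and "Linf_loc orthant u"
    and "pareto_monotone u"
    and "\<forall>x\<in>Gamma_h h. u x = 0"
    and "R > 0"
  shows "\<forall>x\<in>half_open_cube h R. \<forall>y\<in>half_open_cube h R.
    \<bar>u x - u y\<bar> \<le> 2 * (real CARD('n))\<^sup>2 * R powr ((real CARD('n) - 1) / real CARD('n))
      * sup_norm_on (half_open_cube h R) (\<lambda>z. S h z u) powr (1 / real CARD('n))
      * (norm (x - y) powr (1 / real CARD('n)) + h powr (1 / real CARD('n)))"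
proof (intro ballI)
  fix x y :: "real ^ 'n"
  assume x: "x \<in> half_open_cube h R" and y: "y \<in> half_open_cube h R"
  let ?d = "CARD('n)"
  define M where "M = sup_norm_on (half_open_cube h R) (\<lambda>z. S h z u)"
  \<comment> \<open>Boundedness makes the real-valued supremum a genuine upper bound.\<close>
  have abs_M: "\<bar>S h z u\<bar> \<le> M" if "z \<in> half_open_cube h R" for z
    unfolding M_def sup_norm_on_def
    by (rule cSUP_upper[OF that bdd_above_S[OF assms(1,3)]])
  have M0: "0 \<le> M"
    using abs_M[OF x] by linarith
  have SM: "S h z u \<le> M" if "z \<in> half_open_cube h R" for z
    using abs_M[OF that] by linarith
  have mono: "mono_on orthant u"
    using assms(3) by (simp add: pareto_monotone_def)
  have zero: "z \<in> Gamma_h h \<Longrightarrow> u z = 0" for z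
    using assms(4) by blast
  have increment: "u a \<le> u b + real ?d * (real ?d * root ?d M
      * (root ?d (R ^ (?d - 1)) * root ?d (norm (a - b) + h)))"
    if "a \<in> half_open_cube h R" "b \<in> half_open_cube h R" for a b
    using that by (intro increment_le[OF assms(1) mono zero SM M0])
  define C where "C = root ?d M * root ?d (R ^ (?d - 1))"
  have C0: "0 \<le> C"
    using M0 assms(5) by (simp add: C_def)
  \<comment> \<open>The one-sided bound is applied in both orders of \<open>x\<close> and
    \<open>y\<close>.\<close>
  have "\<bar>u x - u y\<bar> \<le> (real ?d)\<^sup>2 * (C * root ?d (norm (x - y) + h))"
    using increment[OF x y] increment[OF y x]
    by (simp add: C_def norm_minus_commute power2_eq_square mult_ac)
  also have "\<dots> \<le> (real ?d)\<^sup>2 * (C * (root ?d (norm (x - y)) + root ?d h))"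
    using C0 assms(1) by (intro mult_left_mono root_add_le) auto
  also have "\<dots> \<le> 2 * ((real ?d)\<^sup>2 * (C * (root ?d (norm (x - y)) + root ?d h)))"
    using C0 assms(1) by simp
  also have "root ?d (R ^ (?d - 1)) = R powr ((real ?d - 1) / real ?d)"
    using assms(5) by (simp add: root_powr_inverse powr_realpow[symmetric] powr_powr of_nat_diff)
  then have "2 * ((real ?d)\<^sup>2 * (C * (root ?d (norm (x - y)) + root ?d h)))
     = 2 * (real ?d)\<^sup>2 * R powr ((real ?d - 1) / real ?d) * M powr (1 / real ?d)
      * (norm (x - y) powr (1 / real ?d) + h powr (1 / real ?d))"
    using M0 assms(1) by (simp add: C_def powr_inverse_eq_root)
  finally show "\<bar>u x - u y\<bar> \<le> 2 * (real ?d)\<^sup>2 * R powr ((real ?d - 1) / real ?d)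
      * sup_norm_on (half_open_cube h R) (\<lambda>z. S h z u) powr (1 / real ?d)
      * (norm (x - y) powr (1 / real ?d) + h powr (1 / real ?d))"
    by (simp add: M_def)
qed

end
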